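(* Let $M,I_1,\dots,I_M,d$ be positive integers with $d\le I_1\cdots I_M$. Let $\mathcal{A},\mathcal{B}\in\mathbb{R}^{I_1\times\cdots\times I_M\times I_1\times\cdots\times I_M}$ be symmetric tensors, with $\mathcal{B}$ positive definite. For $\mathcal{P}\in\mathbb{R}^{I_1\times\cdots\times I_M\times d}$ with $\mathcal{P}^T*_M\mathcal{P}=I_d$ put $$\mathcal{J}_{tr}(\mathcal{P})=\frac{\operatorname{Tr}\left(\mathcal{P}^T*_M\mathcal{A}*_M\mathcal{P}\right)}{\operatorname{Tr}\left(\mathcal{P}^T*_M\mathcal{B}*_M\mathcal{P}\right)}.$$ Let $\mathcal{P}^*$ be a maximizer of $\mathcal{J}_{tr}$ over this constraint set, and let $\rho^*=\mathcal{J}_{tr}(\mathcal{P}^* )$ and $g(\rho^* )=\mathcal{A}-\rho^*\mathcal{B}$. Then there exist an orthogonal matrix $V\in\mathbb{R}^{d\times d}$ and a diagonal matrix $S^*\in\mathbb{R}^{d\times d}$ with $\operatorname{Tr}(S^* )=0$ such that $\mathcal{Q}^*:=\mathcal{P}^*\times_{M+1}V$ satisfies $(\mathcal{Q}^* )^T*_M\mathcal{Q}^*=I_d$ and $$g(\rho^* )*_M\mathcal{Q}^*=\mathcal{Q}^*\times_{M+1}S^*.$$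
   Context: The Einstein product $*_N$ of two tensors contracts the last $N$ modes of the first with the first $N$ modes of the second: $(\mathcal{A}*_N\mathcal{Z})_{i_1\ldots j_1\ldots}=\sum_{k_1,\ldots,k_N}\mathcal{A}_{i_1\ldots k_1\ldots k_N}\mathcal{Z}_{k_1\ldots k_N j_1\ldots}$. For $\mathcal{P}\in\mathbb{R}^{I_1\times\cdots\times I_M\times d}$, the transpose $\mathcal{P}^T\in\mathbb{R}^{d\times I_1\times\cdots\times I_M}$ is $(\mathcal{P}^T)_{j i_1\ldots i_M}=\mathcal{P}_{i_1\ldots i_M j}$; hence $\mathcal{P}^T*_M\mathcal{A}*_M\mathcal{P}$ is a $d\times d$ matrix and $\operatorname{Tr}$ is the matrix trace. For a matrix $Z\in\mathbb{R}^{d\times d}$, the $(M+1)$-mode product is $(\mathcal{P}\times_{M+1}Z)_{i_1\ldots i_M j}=\sum_{k=1}^d Z_{jk}\mathcal{P}_{i_1\ldots i_M k}$. For $\mathcal{A}\in\mathbb{R}^{I_1\times\cdots\times I_M\times I_1\times\cdots\times I_M}$, $(\mathcal{A}^T)_{j_1\ldots j_M i_1\ldots i_M}=\mathcal{A}_{i_1\ldots i_M j_1\ldots j_M}$, and $\mathcal{A}$ is symmetric if $\mathcal{A}^T=\mathcal{A}$. Such a tensor is positive definite if $\langle\mathcal{X},\mathcal{A}*_M\mathcal{X}\rangle>0$ for all nonzero $\mathcal{X}\in\mathbb{R}^{I_1\times\cdots\times I_M}$, where $\langle\cdot,\cdot\rangle$ is the entrywise (Frobenius) inner product. *)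

theory Defs
  imports "Jordan_Normal_Form.Matrix"
begin

section \<open>Real tensors of arbitrary order\<close>

text \<open>
  The order and the dimensions of a tensor are data, not types, since the number of modes is a
  parameter of the mathematics. Indices are 0-based: an index tuple for the dimensions
  \<open>[n_1, ..., n_k]\<close> is a list \<open>[i_1, ..., i_k]\<close> with \<open>i_l < n_l\<close>. Concatenation of index tuples
  is list append. Entries outside the index range are fixed to 0, so that equality of tensors is
  equality of shapes together with equality of all proper entries.
\<close>

definition multi_indices :: "nat list \<Rightarrow> nat list set" where
  "multi_indices ds = {is. length is = length ds \<and> (\<forall>k<length ds. is ! k < ds ! k)}"

typedef tensor =
  "{(ds, f :: nat list \<Rightarrow> real) | ds f. \<forall>is. is \<notin> multi_indices ds \<longrightarrow> f is = 0}"
  by auto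

setup_lifting type_definition_tensor

lift_definition shape :: "tensor \<Rightarrow> nat list" is fst .

lift_definition entry :: "tensor \<Rightarrow> nat list \<Rightarrow> real" is snd .

lift_definition mk_tensor :: "nat list \<Rightarrow> (nat list \<Rightarrow> real) \<Rightarrow> tensor"
  is "\<lambda>ds f. (ds, \<lambda>is. if is \<in> multi_indices ds then f is else 0)"
  by auto

definition tensor_order :: "tensor \<Rightarrow> nat" where
  "tensor_order T = length (shape T)"

lemma shape_mk_tensor [simp]: "shape (mk_tensor ds f) = ds"
  by transfer simp

lemma entry_mk_tensor [simp]: "is \<in> multi_indices ds \<Longrightarrow> entry (mk_tensor ds f) is = f is"
  by transfer simp

lemma entry_outside: "is \<notin> multi_indices (shape T) \<Longrightarrow> entry T is = 0"
  by transfer auto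

lemma tensor_eqI:
  assumes "shape S = shape T"
    and "\<And>is. is \<in> multi_indices (shape T) \<Longrightarrow> entry S is = entry T is"
  shows "S = T"
proof -
  have "entry S = entry T"
    using assms by (metis entry_outside ext)
  with assms(1) show ?thesis
    by transfer (auto simp: prod_eq_iff)
qed

lemma multi_indices_append:
  "multi_indices (ds @ es) = {is @ js | is js. is \<in> multi_indices ds \<and> js \<in> multi_indices es}"
proof (rule Set.set_eqI, rule iffI)
  fix ks assume ks: "ks \<in> multi_indices (ds @ es)"
  have "ks ! k < ds ! k" if "k < length ds" for k
    using ks that by (auto simp: multi_indices_def nth_append dest!: spec[of _ k])
  moreover have "ks ! (length ds + k) < es ! k" if "k < length es" for k
    using ks that by (auto simp: multi_indices_def nth_append dest!: spec[of _ "length ds + k"])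
  ultimately have "take (length ds) ks \<in> multi_indices ds"
    and "drop (length ds) ks \<in> multi_indices es"
    using ks by (auto simp: multi_indices_def)
  then show "ks \<in> {is @ js | is js. is \<in> multi_indices ds \<and> js \<in> multi_indices es}"
    by (metis (mono_tags, lifting) append_take_drop_id mem_Collect_eq)
qed (auto simp: multi_indices_def nth_append)

section \<open>Operations on tensors\<close>

definition tensor_zero :: "nat list \<Rightarrow> tensor" where
  "tensor_zero ds = mk_tensor ds (\<lambda>_. 0)"

text \<open>Only meaningful for operands of the same shape.\<close>

definition tensor_minus :: "tensor \<Rightarrow> tensor \<Rightarrow> tensor" (infixl \<open>-\<^sub>t\<close> 65) where
  "S -\<^sub>t T = mk_tensor (shape T) (\<lambda>is. entry S is - entry T is)"

definition tensor_smult :: "real \<Rightarrow> tensor \<Rightarrow> tensor" (infixr \<open>\<cdot>\<^sub>t\<close> 70) where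
  "c \<cdot>\<^sub>t T = mk_tensor (shape T) (\<lambda>is. c * entry T is)"

definition tensor_inner :: "tensor \<Rightarrow> tensor \<Rightarrow> real" where
  "tensor_inner S T = (\<Sum>is\<in>multi_indices (shape T). entry S is * entry T is)"

text \<open>
  Only meaningful if the last \<open>N\<close> dimensions of the first operand are the first \<open>N\<close> dimensions
  of the second; see \<open>entry_einstein_prod\<close> for the entries.
\<close>

definition einstein_prod :: "tensor \<Rightarrow> nat \<Rightarrow> tensor \<Rightarrow> tensor"
    (\<open>_ \<star>\<^bsub>_\<^esub> _\<close> [71, 0, 72] 71) where
  "S \<star>\<^bsub>N\<^esub> T =
     mk_tensor (take (tensor_order S - N) (shape S) @ drop N (shape T))
       (\<lambda>is. \<Sum>ks\<in>multi_indices (take N (shape T)).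
          entry S (take (tensor_order S - N) is @ ks) * entry T (ks @ drop (tensor_order S - N) is))"

text \<open>
  Exchange of the block of the first \<open>M\<close> modes with the block of the remaining modes. This covers
  both the transpose of an \<open>I_1 \<times> ... \<times> I_M \<times> d\<close> tensor and that of an
  \<open>I_1 \<times> ... \<times> I_M \<times> I_1 \<times> ... \<times> I_M\<close> tensor.
\<close>

definition tensor_transpose :: "nat \<Rightarrow> tensor \<Rightarrow> tensor" where
  "tensor_transpose M T =
     mk_tensor (drop M (shape T) @ take M (shape T))
       (\<lambda>is. entry T (drop (tensor_order T - M) is @ take (tensor_order T - M) is))"

text \<open>The \<open>n\<close>-mode product with a matrix; modes are counted from 1.\<close>

definition mode_prod :: "tensor \<Rightarrow> nat \<Rightarrow> real mat \<Rightarrow> tensor"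
    (\<open>_ \<times>\<^bsub>_\<^esub> _\<close> [71, 0, 72] 71) where
  "T \<times>\<^bsub>n\<^esub> Z =
     mk_tensor ((shape T)[n - 1 := dim_row Z])
       (\<lambda>is. \<Sum>k<shape T ! (n - 1). Z $$ (is ! (n - 1), k) * entry T (is[n - 1 := k]))"

text \<open>Only meaningful for tensors of order 2.\<close>

definition mat_of_tensor :: "tensor \<Rightarrow> real mat" where
  "mat_of_tensor T = mat (shape T ! 0) (shape T ! 1) (\<lambda>(i, j). entry T [i, j])"

lemma entry_einstein_prod:
  assumes "shape S = ds @ ks" "shape T = ks @ es" "length ks = N"
    and "is \<in> multi_indices ds" "js \<in> multi_indices es"
  shows "shape (S \<star>\<^bsub>N\<^esub> T) = ds @ es"
    and "entry (S \<star>\<^bsub>N\<^esub> T) (is @ js) =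
           (\<Sum>k\<in>multi_indices ks. entry S (is @ k) * entry T (k @ js))"
proof -
  have "is @ js \<in> multi_indices (ds @ es)" "length is = length ds"
    using assms by (auto simp: multi_indices_append) (auto simp: multi_indices_def)
  then show "shape (S \<star>\<^bsub>N\<^esub> T) = ds @ es"
    and "entry (S \<star>\<^bsub>N\<^esub> T) (is @ js) =
           (\<Sum>k\<in>multi_indices ks. entry S (is @ k) * entry T (k @ js))"
    using assms by (simp_all add: einstein_prod_def tensor_order_def)
qed

lemma entry_tensor_transpose:
  assumes "shape T = ds @ es" "length ds = M"
    and "is \<in> multi_indices ds" "js \<in> multi_indices es"
  shows "shape (tensor_transpose M T) = es @ ds"
    and "entry (tensor_transpose M T) (js @ is) = entry T (is @ js)"
proof -
  have "js @ is \<in> multi_indices (es @ ds)" "length js = length es"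
    using assms by (auto simp: multi_indices_append) (auto simp: multi_indices_def)
  then show "shape (tensor_transpose M T) = es @ ds"
    and "entry (tensor_transpose M T) (js @ is) = entry T (is @ js)"
    using assms by (simp_all add: tensor_transpose_def tensor_order_def)
qed

lemma entry_mode_prod_last:
  assumes "shape P = ds @ [d]" "length ds = M"
    and "is \<in> multi_indices ds" "j < dim_row Z"
  shows "shape (P \<times>\<^bsub>M + 1\<^esub> Z) = ds @ [dim_row Z]"
    and "entry (P \<times>\<^bsub>M + 1\<^esub> Z) (is @ [j]) = (\<Sum>k<d. Z $$ (j, k) * entry P (is @ [k]))"
proof -
  have "[j] \<in> multi_indices [dim_row Z]"
    using assms by (simp add: multi_indices_def)
  then have "is @ [j] \<in> multi_indices (ds @ [dim_row Z])" "length is = length ds"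
    using assms by (auto simp: multi_indices_append) (auto simp: multi_indices_def)
  then show "shape (P \<times>\<^bsub>M + 1\<^esub> Z) = ds @ [dim_row Z]"
    and "entry (P \<times>\<^bsub>M + 1\<^esub> Z) (is @ [j]) = (\<Sum>k<d. Z $$ (j, k) * entry P (is @ [k]))"
    using assms by (simp_all add: mode_prod_def list_update_append nth_append)
qed

section \<open>Symmetric and positive definite tensors\<close>

definition symmetric_tensor :: "nat list \<Rightarrow> tensor \<Rightarrow> bool" where
  "symmetric_tensor Is A \<longleftrightarrow> shape A = Is @ Is \<and> tensor_transpose (length Is) A = A"

definition pos_def_tensor :: "nat list \<Rightarrow> tensor \<Rightarrow> bool" where
  "pos_def_tensor Is A \<longleftrightarrow> shape A = Is @ Is \<and>
     (\<forall>X. shape X = Is \<and> X \<noteq> tensor_zero Is \<longrightarrow> tensor_inner X (A \<star>\<^bsub>length Is\<^esub> X) > 0)"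

section \<open>Matrices\<close>

definition mat_trace :: "real mat \<Rightarrow> real" where
  "mat_trace Z = (\<Sum>i<dim_row Z. Z $$ (i, i))"

text \<open>
  The constant \<open>orthogonal_mat\<close> of the matrix library only requires nonzero, pairwise orthogonal
  columns, without normalization.
\<close>

definition real_orthogonal_mat :: "real mat \<Rightarrow> bool" where
  "real_orthogonal_mat V \<longleftrightarrow> square_mat V \<and>
     inverts_mat (transpose_mat V) V \<and> inverts_mat V (transpose_mat V)"

section \<open>The trace ratio problem\<close>

definition orthonormal_tensors :: "nat list \<Rightarrow> nat \<Rightarrow> tensor set" where
  "orthonormal_tensors Is d =
     {P. shape P = Is @ [d] \<and>
         mat_of_tensor (tensor_transpose (length Is) P \<star>\<^bsub>length Is\<^esub> P) = 1\<^sub>m d}"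

definition trace_ratio :: "nat \<Rightarrow> tensor \<Rightarrow> tensor \<Rightarrow> tensor \<Rightarrow> real" where
  "trace_ratio M A B P =
     mat_trace (mat_of_tensor (tensor_transpose M P \<star>\<^bsub>M\<^esub> A \<star>\<^bsub>M\<^esub> P)) /
     mat_trace (mat_of_tensor (tensor_transpose M P \<star>\<^bsub>M\<^esub> B \<star>\<^bsub>M\<^esub> P))"

end

theory Submission
  imports Defs "Jordan_Normal_Form.Determinant" "HOL-Analysis.Function_Topology"
begin

text \<open>
  Why the theorem holds. Put \<open>G = A - \<rho> B\<close>. Positive definiteness of \<open>B\<close> makes the denominator of the
  trace ratio positive, so maximality of the ratio at \<open>P\<close> with value \<open>\<rho>\<close> says exactly that
  \<open>Tr (P'\<^sup>T G P') \<le> 0\<close> for every orthonormal \<open>P'\<close>, with equality at \<open>P\<close>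
  (\<open>trace_ratio_maximizer\<close>). Thus \<open>P\<close> maximizes a trace of a symmetric form over orthonormal
  families of \<open>d\<close> vectors.

  Turning a single vector of a maximizing family towards a direction orthogonal to the whole family
  keeps it orthonormal, so the first order term of this perturbation vanishes. Applied to the component
  of \<open>G p\<^sub>j\<close> orthogonal to the span of the family, this shows that the span is invariant under
  \<open>G\<close>: \<open>G P = P L\<close> with \<open>L = P\<^sup>T G P\<close> symmetric (\<open>max_trace_invariant_span\<close>). Diagonalizing
  \<open>L\<close> by an orthogonal matrix turns \<open>P\<close> into a family \<open>Q\<close> of eigenvectors of \<open>G\<close>, and the eigenvalues
  add up to \<open>Tr L = Tr (P\<^sup>T G P) = 0\<close> (\<open>max_trace_eigenbasis\<close>).

  The diagonalization of \<open>L\<close> is itself obtained variationally (\<open>symmetric_diagonalization\<close>): an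
  orthonormal basis \<open>w\<close> that maximizes \<open>\<Sum>i. i * \<langle>w\<^sub>i, L w\<^sub>i\<rangle>\<close> exists by compactness, and
  because the weights are distinct, rotating \<open>w\<^sub>i\<close> and \<open>w\<^sub>j\<close> into each other would increase
  the sum unless \<open>\<langle>w\<^sub>j, L w\<^sub>i\<rangle> = 0\<close>.

  All of this is carried out for real functions on an arbitrary index set. A tensor of shape
  \<open>Is @ [d]\<close> enters as the family of its \<open>d\<close> columns, functions on the multi-indices of \<open>Is\<close>, and a
  tensor of shape \<open>Is @ Is\<close> as a kernel on these multi-indices.
\<close>

section \<open>Inner products and kernels over an index set\<close>

definition dot_on :: "'a set \<Rightarrow> ('a \<Rightarrow> real) \<Rightarrow> ('a \<Rightarrow> real) \<Rightarrow> real" where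
  "dot_on I f g = (\<Sum>x\<in>I. f x * g x)"

definition apply_on :: "'a set \<Rightarrow> ('a \<Rightarrow> 'a \<Rightarrow> real) \<Rightarrow> ('a \<Rightarrow> real) \<Rightarrow> 'a \<Rightarrow> real" where
  "apply_on I G f = (\<lambda>x. \<Sum>y\<in>I. G x y * f y)"

definition quad_on :: "'a set \<Rightarrow> ('a \<Rightarrow> 'a \<Rightarrow> real) \<Rightarrow> ('a \<Rightarrow> real) \<Rightarrow> real" where
  "quad_on I G f = dot_on I f (apply_on I G f)"

definition orthonormal_on :: "'a set \<Rightarrow> nat \<Rightarrow> (nat \<Rightarrow> 'a \<Rightarrow> real) \<Rightarrow> bool" where
  "orthonormal_on I n p \<longleftrightarrow> (\<forall>i<n. \<forall>j<n. dot_on I (p i) (p j) = (if i = j then 1 else 0))"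

definition symmetric_on :: "'a set \<Rightarrow> ('a \<Rightarrow> 'a \<Rightarrow> real) \<Rightarrow> bool" where
  "symmetric_on I G \<longleftrightarrow> (\<forall>x\<in>I. \<forall>y\<in>I. G x y = G y x)"

lemma orthonormal_onD:
  "orthonormal_on I n p \<Longrightarrow> i < n \<Longrightarrow> j < n \<Longrightarrow> dot_on I (p i) (p j) = (if i = j then 1 else 0)"
  by (simp add: orthonormal_on_def)

lemma dot_on_cong:
  "(\<And>x. x \<in> I \<Longrightarrow> f x = f' x) \<Longrightarrow> (\<And>x. x \<in> I \<Longrightarrow> g x = g' x) \<Longrightarrow> dot_on I f g = dot_on I f' g'"
  by (simp add: dot_on_def)

lemma dot_on_commute: "dot_on I f g = dot_on I g f"
  by (simp add: dot_on_def mult.commute)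

lemma dot_on_add_left: "dot_on I (\<lambda>x. f x + g x) h = dot_on I f h + dot_on I g h"
  by (simp add: dot_on_def distrib_right sum.distrib)

lemma dot_on_scale_left: "dot_on I (\<lambda>x. c * f x) h = c * dot_on I f h"
  by (simp add: dot_on_def sum_distrib_left mult.assoc)

lemma dot_on_sum_left: "dot_on I (\<lambda>x. \<Sum>k\<in>K. f k x) h = (\<Sum>k\<in>K. dot_on I (f k) h)"
  unfolding dot_on_def by (subst sum.swap) (simp add: sum_distrib_right)

lemma dot_on_add_right: "dot_on I h (\<lambda>x. f x + g x) = dot_on I h f + dot_on I h g"
  by (simp add: dot_on_commute[of I h] dot_on_add_left)

lemma dot_on_scale_right: "dot_on I h (\<lambda>x. c * f x) = c * dot_on I h f"
  by (simp add: dot_on_commute[of I h] dot_on_scale_left)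

lemma dot_on_sum_right: "dot_on I h (\<lambda>x. \<Sum>k\<in>K. f k x) = (\<Sum>k\<in>K. dot_on I h (f k))"
  by (simp add: dot_on_commute[of I h] dot_on_sum_left)

lemmas dot_on_linear =
  dot_on_add_left dot_on_scale_left dot_on_sum_left
  dot_on_add_right dot_on_scale_right dot_on_sum_right

lemma apply_on_add: "apply_on I G (\<lambda>x. f x + g x) = (\<lambda>x. apply_on I G f x + apply_on I G g x)"
  by (simp add: apply_on_def distrib_left sum.distrib)

lemma apply_on_scale: "apply_on I G (\<lambda>x. c * f x) = (\<lambda>x. c * apply_on I G f x)"
  by (simp add: apply_on_def sum_distrib_left mult.left_commute)

lemma apply_on_sum: "apply_on I G (\<lambda>x. \<Sum>k\<in>K. f k x) = (\<lambda>x. \<Sum>k\<in>K. apply_on I G (f k) x)"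
  unfolding apply_on_def by (subst sum.swap) (simp add: sum_distrib_left)

lemmas apply_on_linear = apply_on_add apply_on_scale apply_on_sum

lemma symmetric_on_dot_apply:
  assumes "symmetric_on I G"
  shows "dot_on I f (apply_on I G g) = dot_on I g (apply_on I G f)"
proof -
  have "dot_on I f (apply_on I G g) = (\<Sum>x\<in>I. \<Sum>y\<in>I. f x * (G x y * g y))"
    by (simp add: dot_on_def apply_on_def sum_distrib_left)
  also have "\<dots> = (\<Sum>y\<in>I. \<Sum>x\<in>I. f x * (G x y * g y))"
    by (rule sum.swap)
  also have "\<dots> = (\<Sum>y\<in>I. \<Sum>x\<in>I. g y * (G y x * f x))"
    using assms by (intro sum.cong refl) (auto simp: symmetric_on_def)
  also have "\<dots> = dot_on I g (apply_on I G f)"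
    by (simp add: dot_on_def apply_on_def sum_distrib_left)
  finally show ?thesis .
qed

lemma dot_on_self_eq_0:
  assumes "finite I" "dot_on I f f = 0" "x \<in> I"
  shows "f x = 0"
  using assms by (simp add: dot_on_def sum_nonneg_eq_0_iff)

lemma dot_on_self_nonneg: "dot_on I f f \<ge> 0"
  by (simp add: dot_on_def sum_nonneg)

lemma quad_on_add:
  assumes "symmetric_on I G"
  shows "quad_on I G (\<lambda>x. f x + t * g x) =
    quad_on I G f + 2 * t * dot_on I g (apply_on I G f) + t\<^sup>2 * quad_on I G g"
  unfolding quad_on_def
  by (simp add: apply_on_linear dot_on_linear symmetric_on_dot_apply[OF assms, of f g]
      power2_eq_square algebra_simps)

lemma quad_on_scale: "quad_on I G (\<lambda>x. c * f x) = c\<^sup>2 * quad_on I G f"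
  by (simp add: quad_on_def apply_on_linear dot_on_linear power2_eq_square)

text \<open>
  The form in which first order optimality is used: both perturbation arguments below lead to a
  quadratic inequality in the parameter \<open>t\<close> without constant term.
\<close>

lemma linear_term_dominated_imp_0:
  fixes b c :: real
  assumes "\<And>t. 2 * t * b \<le> t\<^sup>2 * c"
  shows "b = 0"
proof -
  \<comment> \<open>With \<open>t = b / K\<close> the linear term is \<open>2 b\<^sup>2 / K\<close>, while the quadratic one is at most \<open>b\<^sup>2 / K\<close>.\<close>
  define K where "K = \<bar>c\<bar> + 1"
  have K: "K > 0" "c \<le> K" by (auto simp: K_def)
  have "2 * (b * b / K) \<le> (b / K)\<^sup>2 * c" using assms[of "b / K"] by (simp add: mult_ac)
  also have "\<dots> \<le> (b / K)\<^sup>2 * K" using K by (intro mult_left_mono) auto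
  also have "\<dots> = b * b / K" using K by (simp add: power2_eq_square)
  finally have "b * b / K \<le> 0" by simp
  then have "b * b \<le> 0" using K by (simp add: divide_le_0_iff)
  then show ?thesis by (metis mult_eq_0_iff not_square_less_zero order_le_less)
qed

section \<open>Stationarity of a maximal trace\<close>

text \<open>
  Replacing \<open>p j\<close> by the normalization of \<open>p j + t u\<close> gives another orthonormal family, since \<open>u\<close> is
  orthogonal to all members. Its trace differs to first order in \<open>t\<close> by \<open>2 t \<langle>u, G p\<^sub>j\<rangle>\<close>.
\<close>

lemma max_trace_orthogonal_direction:
  assumes sym: "symmetric_on I G" and on: "orthonormal_on I n p"
    and max: "\<And>p'. orthonormal_on I n p' \<Longrightarrow> (\<Sum>j<n. quad_on I G (p' j)) \<le> (\<Sum>j<n. quad_on I G (p j))"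
    and j: "j < n" and u: "\<And>k. k < n \<Longrightarrow> dot_on I u (p k) = 0"
  shows "dot_on I u (apply_on I G (p j)) = 0"
proof (rule linear_term_dominated_imp_0)
  fix t :: real
  \<comment> \<open>the squared norm of \<open>p j + t u\<close>\<close>
  define N where "N = 1 + t\<^sup>2 * dot_on I u u"
  have N: "N > 0"
    using dot_on_self_nonneg[of I u] by (auto simp: N_def intro!: add_pos_nonneg)
  define f where "f = (\<lambda>x. p j x + t * u x)"
  define g where "g = (\<lambda>x. inverse (sqrt N) * f x)"
  have sqN: "inverse (sqrt N) * inverse (sqrt N) = inverse N"
    using N by (simp flip: inverse_mult_distrib)
  have ff: "dot_on I f f = N"
    using u[OF j] orthonormal_onD[OF on j j]
    by (simp add: f_def N_def dot_on_linear dot_on_commute[of I "p j" u] power2_eq_square)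
  have gg: "dot_on I g g = 1"
    unfolding g_def dot_on_linear ff using N sqN by (simp add: field_simps)
  have gp: "dot_on I g (p k) = 0" if "k < n" "k \<noteq> j" for k
    using u[OF that(1)] orthonormal_onD[OF on j that(1)] that
    by (simp add: g_def f_def dot_on_linear)
  have "orthonormal_on I n (p(j := g))"
    unfolding orthonormal_on_def
  proof (intro allI impI)
    fix k l assume kl: "k < n" "l < n"
    then show "dot_on I ((p(j := g)) k) ((p(j := g)) l) = (if k = l then 1 else 0)"
      using gg gp[OF kl(2)] gp[OF kl(1), folded dot_on_commute[of I "p k"]]
        orthonormal_onD[OF on kl] by (cases "k = j"; cases "l = j") simp_all
  qed
  from max[OF this] have "quad_on I G g \<le> quad_on I G (p j)"
    using j by (simp add: sum.remove[of "{..<n}" j])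
  moreover have "quad_on I G g = quad_on I G f / N"
    unfolding g_def quad_on_scale using sqN by (simp add: power2_eq_square field_simps)
  ultimately have "quad_on I G f \<le> N * quad_on I G (p j)"
    using N by (simp add: field_simps)
  then show "2 * t * dot_on I u (apply_on I G (p j))
      \<le> t\<^sup>2 * (dot_on I u u * quad_on I G (p j) - quad_on I G u)"
    unfolding f_def quad_on_add[OF sym] N_def by (simp add: algebra_simps)
qed

text \<open>
  The residual \<open>r\<close> of \<open>G p\<^sub>j\<close> after projection to the span of \<open>p\<close> is an admissible direction, so
  \<open>\<langle>r, r\<rangle> = \<langle>r, G p\<^sub>j\<rangle> = 0\<close>.
\<close>

lemma max_trace_invariant_span:
  assumes "finite I" and sym: "symmetric_on I G" and on: "orthonormal_on I n p"
    and max: "\<And>p'. orthonormal_on I n p' \<Longrightarrow> (\<Sum>j<n. quad_on I G (p' j)) \<le> (\<Sum>j<n. quad_on I G (p j))"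
    and j: "j < n" and x: "x \<in> I"
  shows "apply_on I G (p j) x = (\<Sum>k<n. dot_on I (p k) (apply_on I G (p j)) * p k x)"
proof -
  let ?L = "\<lambda>k. dot_on I (p k) (apply_on I G (p j))"
  define r where "r = (\<lambda>x. apply_on I G (p j) x + (-1) * (\<Sum>k<n. ?L k * p k x))"
  have rp: "dot_on I r (p k) = 0" if k: "k < n" for k
  proof -
    have "dot_on I (\<lambda>x. \<Sum>k<n. ?L k * p k x) (p k) = (\<Sum>l<n. ?L l * dot_on I (p l) (p k))"
      by (simp add: dot_on_linear)
    also have "\<dots> = (\<Sum>l<n. if l = k then ?L l else 0)"
      using k by (intro sum.cong) (auto simp: orthonormal_onD[OF on])
    also have "\<dots> = ?L k" using k by simp
    finally show ?thesis
      unfolding r_def by (simp only: dot_on_add_left dot_on_scale_left)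
        (simp add: dot_on_commute)
  qed
  have "dot_on I r r = dot_on I r (apply_on I G (p j)) - (\<Sum>k<n. ?L k * dot_on I r (p k))"
  proof -
    have "dot_on I r r = dot_on I r (\<lambda>x. apply_on I G (p j) x + (-1) * (\<Sum>k<n. ?L k * p k x))"
      by (simp only: r_def)
    then show ?thesis by (simp only: dot_on_add_right dot_on_scale_right dot_on_sum_right)
  qed
  also have "\<dots> = 0"
    using max_trace_orthogonal_direction[OF sym on max j rp] rp by simp
  finally have "r x = 0" using dot_on_self_eq_0[OF \<open>finite I\<close> _ x] by blast
  then show ?thesis by (simp add: r_def)
qed

section \<open>Diagonalization of a symmetric matrix\<close>

text \<open>
  The one place where the number of vectors equals the dimension: a right inverse of a square matrix
  is a left inverse.
\<close>

lemma orthonormal_rows_imp_columns: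
  assumes "orthonormal_on {..<n} n w"
  shows "orthonormal_on {..<n} n (\<lambda>k i. w i k)"
proof -
  define W where "W = mat n n (\<lambda>(i, k). w i k)"
  have W: "W \<in> carrier_mat n n" by (simp add: W_def)
  have "W * transpose_mat W = 1\<^sub>m n"
    using orthonormal_onD[OF assms]
    by (intro eq_matI) (auto simp: W_def scalar_prod_def dot_on_def lessThan_atLeast0)
  then have 1: "transpose_mat W * W = 1\<^sub>m n"
    using mat_mult_left_right_inverse W by (metis transpose_carrier_mat)
  have "(\<Sum>i<n. w i k * w i l) = (if k = l then 1 else 0)" if "k < n" "l < n" for k l
  proof -
    have "(transpose_mat W * W) $$ (k, l) = (\<Sum>i<n. w i k * w i l)"
      using that by (simp add: W_def scalar_prod_def lessThan_atLeast0)
    then show ?thesis using that by (simp add: 1)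
  qed
  then show ?thesis by (simp add: orthonormal_on_def dot_on_def)
qed

lemma orthonormal_expansion:
  assumes "orthonormal_on {..<n} n w" and "k < n"
  shows "f k = (\<Sum>i<n. dot_on {..<n} (w i) f * w i k)"
proof -
  have "(\<Sum>i<n. dot_on {..<n} (w i) f * w i k) = (\<Sum>i<n. \<Sum>l<n. w i l * f l * w i k)"
    by (simp add: dot_on_def sum_distrib_right)
  also have "\<dots> = (\<Sum>l<n. f l * dot_on {..<n} (\<lambda>i. w i l) (\<lambda>i. w i k))"
    by (subst sum.swap) (simp add: dot_on_def sum_distrib_left mult_ac)
  also have "\<dots> = (\<Sum>l<n. if l = k then f l else 0)"
    using orthonormal_onD[OF orthonormal_rows_imp_columns[OF assms(1)]] assms(2)
    by (intro sum.cong) auto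
  also have "\<dots> = f k" using assms(2) by simp
  finally show ?thesis by simp
qed

text \<open>
  The orthogonal group is compact. Families \<open>nat \<Rightarrow> nat \<Rightarrow> real\<close> carry entries outside the \<open>n \<times> n\<close>
  block, which would spoil compactness; the functional is therefore required to see only the block, and
  the maximization runs over families vanishing outside of it. Uncurrying to \<open>nat \<times> nat\<close> makes this a
  closed subset of a product of compact intervals.
\<close>

lemma orthonormal_family_attains_sup:
  fixes \<Phi> :: "(nat \<Rightarrow> nat \<Rightarrow> real) \<Rightarrow> real"
  assumes cong: "\<And>w w'. (\<And>i k. i < n \<Longrightarrow> k < n \<Longrightarrow> w i k = w' i k) \<Longrightarrow> \<Phi> w = \<Phi> w'"
    and cont: "continuous_on UNIV (\<lambda>W. \<Phi> (\<lambda>i k. W (i, k)))"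
  obtains w where "orthonormal_on {..<n} n w"
    and "\<And>w'. orthonormal_on {..<n} n w' \<Longrightarrow> \<Phi> w' \<le> \<Phi> w"
proof -
  let ?D = "{..<n} \<times> {..<n}"
  let ?box = "PiE UNIV (\<lambda>x. if x \<in> ?D then {-1..1} else {0::real})"
  define on where "on = {W :: nat \<times> nat \<Rightarrow> real. orthonormal_on {..<n} n (\<lambda>i k. W (i, k))}"
  define trim where "trim w = (\<lambda>x. if x \<in> ?D then w (fst x) (snd x) else 0)"
    for w :: "nat \<Rightarrow> nat \<Rightarrow> real"
  have "compact ?box"
    unfolding compactin_euclidean_iff[symmetric] euclidean_product_topology[symmetric]
    by (subst compactin_PiE) auto
  moreover have "closed on"
  proof -
    have "on = (\<Inter>i\<in>{..<n}. \<Inter>j\<in>{..<n}.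
        {W. (\<Sum>k<n. W (i, k) * W (j, k)) = (if i = j then 1 else 0)})"
      by (auto simp: on_def orthonormal_on_def dot_on_def)
    moreover have "closed \<dots>"
      by (intro closed_INT ballI closed_Collect_eq continuous_intros) auto
    ultimately show ?thesis by simp
  qed
  ultimately have "compact (?box \<inter> on)" by (rule compact_Int_closed)
  moreover have trim_mem: "trim w \<in> ?box \<inter> on" if w: "orthonormal_on {..<n} n w" for w
  proof
    have "\<bar>w i k\<bar> \<le> 1" if "i < n" "k < n" for i k
    proof -
      have "(w i k)\<^sup>2 \<le> (\<Sum>k<n. (w i k)\<^sup>2)"
        using that by (intro member_le_sum) auto
      also have "\<dots> = 1"
        using orthonormal_onD[OF w that(1) that(1)] by (simp add: dot_on_def power2_eq_square)
      finally show ?thesis by (simp add: abs_square_le_1)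
    qed
    then show "trim w \<in> ?box"
      by (auto simp: trim_def PiE_iff abs_le_iff)
    show "trim w \<in> on"
      using w by (simp add: on_def trim_def orthonormal_on_def dot_on_def)
  qed
  moreover have "orthonormal_on {..<n} n (\<lambda>i k. if i = k then 1 else 0)"
    by (auto simp: orthonormal_on_def dot_on_def if_distrib[of "\<lambda>x. x * _"] cong: if_cong)
  moreover have "continuous_on (?box \<inter> on) (\<lambda>W. \<Phi> (\<lambda>i k. W (i, k)))"
    using cont continuous_on_subset by blast
  ultimately obtain W where W: "W \<in> ?box \<inter> on"
    and max: "\<And>W'. W' \<in> ?box \<inter> on \<Longrightarrow> \<Phi> (\<lambda>i k. W' (i, k)) \<le> \<Phi> (\<lambda>i k. W (i, k))"
    using continuous_attains_sup[of "?box \<inter> on" "\<lambda>W. \<Phi> (\<lambda>i k. W (i, k))"] by blast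
  show thesis
  proof (rule that)
    show "orthonormal_on {..<n} n (\<lambda>i k. W (i, k))" using W by (simp add: on_def)
    fix w' assume w': "orthonormal_on {..<n} n w'"
    have "\<Phi> w' = \<Phi> (\<lambda>i k. trim w' (i, k))" by (rule cong) (simp add: trim_def)
    also have "\<dots> \<le> \<Phi> (\<lambda>i k. W (i, k))" using trim_mem[OF w'] by (rule max)
    finally show "\<Phi> w' \<le> \<Phi> (\<lambda>i k. W (i, k))" .
  qed
qed

text \<open>
  The spectral theorem for real symmetric matrices, with the eigenvectors as rows of \<open>w\<close>. For a
  maximizer of the weighted sum \<open>\<Phi>\<close>, the rotation of \<open>w\<^sub>i, w\<^sub>j\<close> by the angle \<open>arctan t\<close> changes
  \<open>\<Phi>\<close> to first order by \<open>2 t (i - j) \<langle>w\<^sub>j, L w\<^sub>i\<rangle>\<close>, so that the off-diagonal entries of \<open>L\<close> in the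
  basis \<open>w\<close> vanish.
\<close>

lemma symmetric_diagonalization:
  fixes L :: "nat \<Rightarrow> nat \<Rightarrow> real"
  assumes sym: "symmetric_on {..<n} L"
  obtains w s where "orthonormal_on {..<n} n w"
    and "\<And>j k. j < n \<Longrightarrow> k < n \<Longrightarrow> apply_on {..<n} L (w j) k = s j * w j k"
proof -
  let ?q = "quad_on {..<n} L"
  let ?\<Phi> = "\<lambda>w. \<Sum>i<n. real i * ?q (w i)"
  have "?\<Phi> w = ?\<Phi> w'" if "\<And>i k. i < n \<Longrightarrow> k < n \<Longrightarrow> w i k = w' i k" for w w'
    using that by (intro sum.cong) (auto simp: quad_on_def dot_on_def apply_on_def)
  moreover have "continuous_on UNIV (\<lambda>W. \<Sum>i<n. real i * ?q (\<lambda>k. W (i, k)))"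
    unfolding quad_on_def dot_on_def apply_on_def by (intro continuous_intros) auto
  ultimately obtain w where on: "orthonormal_on {..<n} n w"
    and max: "\<And>w'. orthonormal_on {..<n} n w' \<Longrightarrow> ?\<Phi> w' \<le> ?\<Phi> w"
    using orthonormal_family_attains_sup[of n ?\<Phi>] by blast
  have offdiag: "dot_on {..<n} (w j) (apply_on {..<n} L (w i)) = 0"
    if i: "i < n" and j: "j < n" and ij: "i \<noteq> j" for i j
  proof -
    let ?b = "dot_on {..<n} (w j) (apply_on {..<n} L (w i))"
    have "(real i - real j) * ?b = 0"
    proof (rule linear_term_dominated_imp_0)
      fix t :: real
      define N where "N = 1 + t\<^sup>2"
      have N: "N > 0" by (auto simp: N_def intro!: add_pos_nonneg)
      \<comment> \<open>\<open>c\<close> and \<open>c t\<close> are the cosine and the sine of the rotation angle.\<close>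
      define c where "c = inverse (sqrt N)"
      have c2: "c * c = inverse N"
        using N by (simp add: c_def flip: inverse_mult_distrib)
      then have cN: "c * c + c * (c * (t * t)) = 1"
        using N by (simp add: N_def power2_eq_square field_simps)
      define f where "f = (\<lambda>k. c * (w i k + t * w j k))"
      define g where "g = (\<lambda>k. c * (w j k + (-t) * w i k))"
      note dots = orthonormal_onD[OF on i i] orthonormal_onD[OF on j j]
        orthonormal_onD[OF on i j] orthonormal_onD[OF on j i]
      have fg: "dot_on {..<n} f f = 1" "dot_on {..<n} g g = 1" "dot_on {..<n} f g = 0"
        unfolding f_def g_def dot_on_linear dots using ij cN by (simp_all add: algebra_simps)
      have fw: "dot_on {..<n} f (w k) = 0" "dot_on {..<n} g (w k) = 0"
        if "k < n" "k \<noteq> i" "k \<noteq> j" for k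
        unfolding f_def g_def dot_on_linear
        using orthonormal_onD[OF on i that(1)] orthonormal_onD[OF on j that(1)] that by auto
      have fg': "dot_on {..<n} g f = 0"
        by (subst dot_on_commute) (rule fg(3))
      have fw': "dot_on {..<n} (w k) f = 0" "dot_on {..<n} (w k) g = 0"
        if "k < n" "k \<noteq> i" "k \<noteq> j" for k
        using fw[OF that] by (simp_all only: dot_on_commute[of _ "w k"])
      define w' where "w' = w(i := f, j := g)"
      have w'_upd: "w' i = f" "w' j = g" and w'_other: "\<And>k. k \<noteq> i \<Longrightarrow> k \<noteq> j \<Longrightarrow> w' k = w k"
        using ij by (auto simp: w'_def)
      have "orthonormal_on {..<n} n w'"
        unfolding orthonormal_on_def
      proof (intro allI impI)
        fix k l assume kl: "k < n" "l < n"
        show "dot_on {..<n} (w' k) (w' l) = (if k = l then 1 else 0)"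
        proof (cases "k \<in> {i, j}")
          case True
          then show ?thesis
            using fg fg' fw[OF kl(2)] ij w'_upd w'_other by (cases "l \<in> {i, j}") auto
        next
          case False
          then show ?thesis
            using fw'[OF kl(1)] orthonormal_onD[OF on kl] w'_upd w'_other
            by (cases "l \<in> {i, j}") auto
        qed
      qed
      then have "?\<Phi> w' \<le> ?\<Phi> w" by (rule max)
      moreover have split: "?\<Phi> v = real i * ?q (v i) + (real j * ?q (v j) +
          (\<Sum>k\<in>{..<n} - {i} - {j}. real k * ?q (v k)))" for v
      proof -
        have "?\<Phi> v = real i * ?q (v i) + (\<Sum>k\<in>{..<n} - {i}. real k * ?q (v k))"
          using i by (intro sum.remove) auto
        also have "(\<Sum>k\<in>{..<n} - {i}. real k * ?q (v k)) =
            real j * ?q (v j) + (\<Sum>k\<in>{..<n} - {i} - {j}. real k * ?q (v k))"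
          using j ij by (intro sum.remove) auto
        finally show ?thesis .
      qed
      moreover have "(\<Sum>k\<in>{..<n} - {i} - {j}. real k * ?q (w' k)) =
          (\<Sum>k\<in>{..<n} - {i} - {j}. real k * ?q (w k))"
        by (intro sum.cong) (auto simp: w'_def)
      ultimately have "real i * ?q f + real j * ?q g \<le> real i * ?q (w i) + real j * ?q (w j)"
        using ij by (simp add: w'_def)
      moreover have "?q f = inverse N * (?q (w i) + 2 * t * ?b + t\<^sup>2 * ?q (w j))"
        unfolding f_def quad_on_scale quad_on_add[OF sym] by (simp add: power2_eq_square c2)
      moreover have "?q g = inverse N * (?q (w j) - 2 * t * ?b + t\<^sup>2 * ?q (w i))"
        unfolding g_def quad_on_scale quad_on_add[OF sym]
          symmetric_on_dot_apply[OF sym, of "w i" "w j"] by (simp add: power2_eq_square c2)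
      ultimately have "inverse N * (real i * (?q (w i) + 2 * t * ?b + t\<^sup>2 * ?q (w j))
          + real j * (?q (w j) - 2 * t * ?b + t\<^sup>2 * ?q (w i)))
          \<le> real i * ?q (w i) + real j * ?q (w j)"
        by (simp add: algebra_simps)
      then have "real i * (?q (w i) + 2 * t * ?b + t\<^sup>2 * ?q (w j))
          + real j * (?q (w j) - 2 * t * ?b + t\<^sup>2 * ?q (w i))
          \<le> N * (real i * ?q (w i) + real j * ?q (w j))"
        using N by (simp add: field_simps)
      then show "2 * t * ((real i - real j) * ?b)
          \<le> t\<^sup>2 * ((real i - real j) * (?q (w i) - ?q (w j)))"
        unfolding N_def by (simp add: algebra_simps)
    qed
    then show ?thesis using ij by simp
  qed
  show thesis
  proof (rule that[OF on])
    fix j k assume j: "j < n" and k: "k < n"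
    have "apply_on {..<n} L (w j) k =
        (\<Sum>i<n. dot_on {..<n} (w i) (apply_on {..<n} L (w j)) * w i k)"
      by (rule orthonormal_expansion[OF on k])
    also have "\<dots> = (\<Sum>i<n. if i = j then ?q (w j) * w j k else 0)"
      using offdiag j by (intro sum.cong) (auto simp: quad_on_def)
    also have "\<dots> = ?q (w j) * w j k" using j by simp
    finally show "apply_on {..<n} L (w j) k = ?q (w j) * w j k" .
  qed
qed

section \<open>An eigenbasis of the span\<close>

lemma orthonormal_on_rotate:
  assumes p: "orthonormal_on I n p" and w: "orthonormal_on {..<n} n w"
  shows "orthonormal_on I n (\<lambda>j x. \<Sum>k<n. w j k * p k x)"
proof -
  have "dot_on I (\<lambda>x. \<Sum>k<n. w i k * p k x) (\<lambda>x. \<Sum>k<n. w j k * p k x) = dot_on {..<n} (w i) (w j)"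
    for i j
  proof -
    have "dot_on I (\<lambda>x. \<Sum>k<n. w i k * p k x) (\<lambda>x. \<Sum>l<n. w j l * p l x)
        = (\<Sum>k<n. \<Sum>l<n. w i k * (w j l * dot_on I (p k) (p l)))"
      by (simp add: dot_on_linear sum_distrib_left)
    also have "\<dots> = (\<Sum>k<n. \<Sum>l<n. if l = k then w i k * w j k else 0)"
      using orthonormal_onD[OF p] by (intro sum.cong refl) auto
    also have "\<dots> = dot_on {..<n} (w i) (w j)"
      by (simp add: dot_on_def)
    finally show ?thesis .
  qed
  then show ?thesis using w by (simp add: orthonormal_on_def)
qed

text \<open>
  With \<open>L k l = \<langle>p\<^sub>k, G p\<^sub>l\<rangle>\<close>, invariance of the span says that \<open>G\<close> acts on coordinate vectors with
  respect to \<open>p\<close> as the matrix \<open>L\<close>. An eigenvector \<open>w\<^sub>j\<close> of \<open>L\<close> is therefore the coordinate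
  vector of an eigenvector of \<open>G\<close>. The sum of the eigenvalues is the trace of \<open>L\<close>.
\<close>

lemma max_trace_eigenbasis:
  assumes "finite I" and sym: "symmetric_on I G" and on: "orthonormal_on I n p"
    and max: "\<And>p'. orthonormal_on I n p' \<Longrightarrow> (\<Sum>j<n. quad_on I G (p' j)) \<le> (\<Sum>j<n. quad_on I G (p j))"
  shows "\<exists>w s. orthonormal_on {..<n} n w \<and> (\<Sum>j<n. s j) = (\<Sum>j<n. quad_on I G (p j)) \<and>
    (\<forall>j<n. \<forall>x\<in>I. apply_on I G (\<lambda>x. \<Sum>k<n. w j k * p k x) x =
      s j * (\<Sum>k<n. w j k * p k x))"
proof -
  define L where "L k l = dot_on I (p k) (apply_on I G (p l))" for k l
  have "symmetric_on {..<n} L"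
    using symmetric_on_dot_apply[OF sym] by (auto simp: symmetric_on_def L_def)
  then obtain w s where w: "orthonormal_on {..<n} n w"
    and ev: "\<And>j k. j < n \<Longrightarrow> k < n \<Longrightarrow> apply_on {..<n} L (w j) k = s j * w j k"
    using symmetric_diagonalization by blast
  have eigen: "apply_on I G (\<lambda>x. \<Sum>k<n. w j k * p k x) x = s j * (\<Sum>k<n. w j k * p k x)"
    if j: "j < n" and x: "x \<in> I" for j x
  proof -
    have "apply_on I G (\<lambda>x. \<Sum>k<n. w j k * p k x) x = (\<Sum>l<n. w j l * apply_on I G (p l) x)"
      by (simp add: apply_on_linear)
    also have "\<dots> = (\<Sum>l<n. w j l * (\<Sum>k<n. L k l * p k x))"
      using max_trace_invariant_span[OF \<open>finite I\<close> sym on max _ x] by (simp add: L_def)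
    also have "\<dots> = (\<Sum>k<n. apply_on {..<n} L (w j) k * p k x)"
      unfolding apply_on_def sum_distrib_left sum_distrib_right
      by (subst sum.swap) (simp add: mult_ac)
    also have "\<dots> = s j * (\<Sum>k<n. w j k * p k x)"
      using ev[OF j] by (simp add: sum_distrib_left mult.assoc)
    finally show ?thesis .
  qed
  \<comment> \<open>Invariance of the trace: orthonormality of the rows of \<open>w\<close> brings \<open>L\<close> in, and that of its columns
    removes \<open>w\<close>.\<close>
  have "(\<Sum>j<n. s j) = (\<Sum>j<n. \<Sum>k<n. w j k * (s j * w j k))"
  proof (intro sum.cong refl)
    fix j assume "j \<in> {..<n}"
    then have "(\<Sum>k<n. w j k * w j k) = 1"
      using orthonormal_onD[OF w, of j j] by (simp add: dot_on_def)
    then have "s j = s j * (\<Sum>k<n. w j k * w j k)" by simp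
    also have "\<dots> = (\<Sum>k<n. w j k * (s j * w j k))"
      by (simp add: sum_distrib_left mult_ac)
    finally show "s j = (\<Sum>k<n. w j k * (s j * w j k))" .
  qed
  also have "\<dots> = (\<Sum>j<n. \<Sum>k<n. \<Sum>l<n. w j k * (L k l * w j l))"
  proof (intro sum.cong refl)
    fix j k assume "j \<in> {..<n}" "k \<in> {..<n}"
    then show "w j k * (s j * w j k) = (\<Sum>l<n. w j k * (L k l * w j l))"
      using ev[of j k] by (simp add: apply_on_def flip: sum_distrib_left)
  qed
  also have "\<dots> = (\<Sum>k<n. \<Sum>l<n. \<Sum>j<n. w j k * (L k l * w j l))"
    by (subst sum.swap) (intro sum.cong refl sum.swap)
  also have "\<dots> = (\<Sum>k<n. \<Sum>l<n. L k l * dot_on {..<n} (\<lambda>j. w j k) (\<lambda>j. w j l))"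
    by (simp add: dot_on_def sum_distrib_left mult_ac)
  also have "\<dots> = (\<Sum>k<n. \<Sum>l<n. if l = k then L k k else 0)"
    using orthonormal_onD[OF orthonormal_rows_imp_columns[OF w]] by (intro sum.cong refl) auto
  also have "\<dots> = (\<Sum>k<n. quad_on I G (p k))"
    by (simp add: L_def quad_on_def)
  finally show ?thesis using w eigen by blast
qed

section \<open>Tensors as kernels and families of functions\<close>

definition column :: "tensor \<Rightarrow> nat \<Rightarrow> nat list \<Rightarrow> real" where
  "column P j = (\<lambda>x. entry P (x @ [j]))"

definition kernel_of :: "tensor \<Rightarrow> nat list \<Rightarrow> nat list \<Rightarrow> real" where
  "kernel_of A = (\<lambda>x y. entry A (x @ y))"

definition tensor_of_columns :: "nat list \<Rightarrow> nat \<Rightarrow> (nat \<Rightarrow> nat list \<Rightarrow> real) \<Rightarrow> tensor" where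
  "tensor_of_columns Is d p = mk_tensor (Is @ [d]) (\<lambda>is. p (last is) (butlast is))"

lemma finite_multi_indices: "finite (multi_indices ds)"
proof (rule finite_subset)
  show "multi_indices ds \<subseteq> {xs. set xs \<subseteq> {..<sum_list ds} \<and> length xs = length ds}"
  proof
    fix xs assume xs: "xs \<in> multi_indices ds"
    have "x < sum_list ds" if x: "x \<in> set xs" for x
    proof -
      obtain k where k: "k < length xs" "xs ! k = x"
        using x[unfolded in_set_conv_nth] by blast
      then have "k < length ds" "x < ds ! k"
        using xs by (auto simp: multi_indices_def)
      then show ?thesis
        using elem_le_sum_list[of k ds] by simp
    qed
    then show "xs \<in> {xs. set xs \<subseteq> {..<sum_list ds} \<and> length xs = length ds}"
      using xs by (auto simp: multi_indices_def)
  qed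
  show "finite {xs. set xs \<subseteq> {..<sum_list ds} \<and> length xs = length ds}"
    by (rule finite_lists_length_eq) simp
qed

lemma multi_indices_Nil: "multi_indices [] = {[]}"
  by (auto simp: multi_indices_def)

lemma singleton_mem_multi_indices: "[j] \<in> multi_indices [d] \<longleftrightarrow> j < d"
  by (simp add: multi_indices_def)

lemma multi_indices_snocE:
  assumes "is \<in> multi_indices (ds @ [d])"
  obtains x j where "is = x @ [j]" "x \<in> multi_indices ds" "j < d"
proof -
  obtain x js where 1: "is = x @ js" "x \<in> multi_indices ds" "js \<in> multi_indices [d]"
    using assms unfolding multi_indices_append by blast
  moreover obtain j where "js = [j]"
    using 1(3) that by (cases js) (simp_all add: multi_indices_def)
  ultimately show ?thesis using that by (simp add: singleton_mem_multi_indices)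
qed

lemma append_mem_multi_indices:
  "x \<in> multi_indices ds \<Longrightarrow> y \<in> multi_indices es \<Longrightarrow> x @ y \<in> multi_indices (ds @ es)"
  by (auto simp: multi_indices_append)

lemma shape_tensor_transpose:
  "shape T = ds @ es \<Longrightarrow> length ds = M \<Longrightarrow> shape (tensor_transpose M T) = es @ ds"
  by (simp add: tensor_transpose_def)

lemma shape_einstein_prod:
  "shape S = ds @ ks \<Longrightarrow> shape T = ks @ es \<Longrightarrow> length ks = N \<Longrightarrow>
    shape (S \<star>\<^bsub>N\<^esub> T) = ds @ es"
  by (simp add: einstein_prod_def tensor_order_def)

lemma shape_tensor_of_columns: "shape (tensor_of_columns Is d p) = Is @ [d]"
  by (simp add: tensor_of_columns_def)

lemma column_tensor_of_columns:
  "x \<in> multi_indices Is \<Longrightarrow> j < d \<Longrightarrow> column (tensor_of_columns Is d p) j x = p j x"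
  by (simp add: column_def tensor_of_columns_def append_mem_multi_indices
      singleton_mem_multi_indices)

lemma entry_transpose_column:
  "shape P = Is @ [d] \<Longrightarrow> x \<in> multi_indices Is \<Longrightarrow> i < d \<Longrightarrow>
    entry (tensor_transpose (length Is) P) ([i] @ x) = column P i x"
  unfolding column_def
  by (rule entry_tensor_transpose(2)) (auto simp: singleton_mem_multi_indices)

lemma mat_of_tensor_gram:
  assumes P: "shape P = Is @ [d]"
  shows "mat_of_tensor (tensor_transpose (length Is) P \<star>\<^bsub>length Is\<^esub> P) =
    mat d d (\<lambda>(i, j). dot_on (multi_indices Is) (column P i) (column P j))"
proof -
  have PT: "shape (tensor_transpose (length Is) P) = [d] @ Is"
    using P by (rule shape_tensor_transpose) simp
  have "entry (tensor_transpose (length Is) P \<star>\<^bsub>length Is\<^esub> P) ([i] @ [j]) =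
      dot_on (multi_indices Is) (column P i) (column P j)" if "i < d" "j < d" for i j
    using that entry_transpose_column[OF P]
    by (subst entry_einstein_prod(2)[OF PT P refl])
      (auto simp: singleton_mem_multi_indices dot_on_def column_def)
  then show ?thesis
    using shape_einstein_prod[OF PT P refl]
    by (intro eq_matI) (auto simp: mat_of_tensor_def)
qed

lemma orthonormal_tensors_iff:
  "P \<in> orthonormal_tensors Is d \<longleftrightarrow>
    shape P = Is @ [d] \<and> orthonormal_on (multi_indices Is) d (column P)"
proof -
  have "mat d d (\<lambda>(i, j). dot_on (multi_indices Is) (column P i) (column P j)) = 1\<^sub>m d \<longleftrightarrow>
      orthonormal_on (multi_indices Is) d (column P)"
    by (auto simp: orthonormal_on_def mat_eq_iff)
  then show ?thesis
    by (auto simp: orthonormal_tensors_def mat_of_tensor_gram)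
qed

lemma mat_trace_congruence:
  assumes P: "shape P = Is @ [d]" and A: "shape A = Is @ Is"
  shows "mat_trace (mat_of_tensor
      (tensor_transpose (length Is) P \<star>\<^bsub>length Is\<^esub> A \<star>\<^bsub>length Is\<^esub> P)) =
    (\<Sum>j<d. quad_on (multi_indices Is) (kernel_of A) (column P j))"
proof -
  let ?I = "multi_indices Is"
  let ?PA = "tensor_transpose (length Is) P \<star>\<^bsub>length Is\<^esub> A"
  have PT: "shape (tensor_transpose (length Is) P) = [d] @ Is"
    using P by (rule shape_tensor_transpose) simp
  have PA: "shape ?PA = [d] @ Is"
    by (rule shape_einstein_prod[OF PT A refl])
  have ePA: "entry ?PA ([j] @ y) = (\<Sum>x\<in>?I. column P j x * kernel_of A x y)"
    if "j < d" "y \<in> ?I" for j y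
    using that entry_transpose_column[OF P]
    by (subst entry_einstein_prod(2)[OF PT A refl])
      (auto simp: singleton_mem_multi_indices kernel_of_def)
  have "entry (?PA \<star>\<^bsub>length Is\<^esub> P) ([j] @ [j]) = quad_on ?I (kernel_of A) (column P j)"
    if j: "j < d" for j
  proof -
    have "entry (?PA \<star>\<^bsub>length Is\<^esub> P) ([j] @ [j]) =
        (\<Sum>y\<in>?I. entry ?PA ([j] @ y) * column P j y)"
      using j by (subst entry_einstein_prod(2)[OF PA P refl])
        (auto simp: singleton_mem_multi_indices column_def)
    also have "\<dots> = (\<Sum>y\<in>?I. \<Sum>x\<in>?I. column P j x * (kernel_of A x y * column P j y))"
      using ePA[OF j] by (simp add: sum_distrib_right mult.assoc)
    also have "\<dots> = quad_on ?I (kernel_of A) (column P j)"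
      by (subst sum.swap) (simp add: quad_on_def dot_on_def apply_on_def sum_distrib_left)
    finally show ?thesis .
  qed
  then show ?thesis
    using shape_einstein_prod[OF PA P refl]
    by (simp add: mat_trace_def mat_of_tensor_def)
qed

lemma symmetric_tensor_imp_symmetric_on:
  assumes "symmetric_tensor Is A"
  shows "symmetric_on (multi_indices Is) (kernel_of A)"
  using assms entry_tensor_transpose(2)[of A Is Is "length Is"]
  by (auto simp: symmetric_on_def kernel_of_def symmetric_tensor_def)

lemma pos_def_tensor_quad_pos:
  assumes B: "pos_def_tensor Is B" and f: "x \<in> multi_indices Is" "f x \<noteq> 0"
  shows "quad_on (multi_indices Is) (kernel_of B) f > 0"
proof -
  let ?X = "mk_tensor Is f"
  have sB: "shape B = Is @ Is" using B by (simp add: pos_def_tensor_def)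
  have sX: "shape ?X = Is @ []" by simp
  have "entry (tensor_zero Is) x = 0" using f by (simp add: tensor_zero_def)
  moreover have "entry ?X x \<noteq> 0" using f by simp
  ultimately have "?X \<noteq> tensor_zero Is" by metis
  then have "tensor_inner ?X (B \<star>\<^bsub>length Is\<^esub> ?X) > 0"
    using B by (simp add: pos_def_tensor_def)
  moreover have "entry (B \<star>\<^bsub>length Is\<^esub> ?X) x = apply_on (multi_indices Is) (kernel_of B) f x"
    if "x \<in> multi_indices Is" for x
    using entry_einstein_prod(2)[OF sB sX refl that, of "[]"]
    by (simp add: multi_indices_Nil apply_on_def kernel_of_def)
  ultimately show ?thesis
    using shape_einstein_prod[OF sB sX refl]
    by (simp add: tensor_inner_def quad_on_def dot_on_def)
qed

lemma column_mode_prod: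
  assumes P: "shape P = Is @ [d]" and Z: "Z \<in> carrier_mat n d"
    and "x \<in> multi_indices Is" "j < n"
  shows "column (P \<times>\<^bsub>length Is + 1\<^esub> Z) j x = (\<Sum>k<d. Z $$ (j, k) * column P k x)"
  using entry_mode_prod_last(2)[OF P refl assms(3), of j Z] assms
  by (simp add: column_def)

lemma shape_mode_prod_last:
  assumes P: "shape P = Is @ [d]" and Z: "Z \<in> carrier_mat n d"
  shows "shape (P \<times>\<^bsub>length Is + 1\<^esub> Z) = Is @ [n]"
  using assms by (simp add: mode_prod_def)

lemma column_einstein_prod:
  assumes "shape A = Is @ Is" "shape P = Is @ [d]" "x \<in> multi_indices Is" "j < d"
  shows "column (A \<star>\<^bsub>length Is\<^esub> P) j x = apply_on (multi_indices Is) (kernel_of A) (column P j) x"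
  using entry_einstein_prod(2)[OF assms(1,2) refl assms(3), of "[j]"] assms(4)
  by (simp add: column_def apply_on_def kernel_of_def singleton_mem_multi_indices)

lemma tensor_eq_columnsI:
  assumes "shape S = Is @ [d]" "shape T = Is @ [d]"
    and "\<And>x j. x \<in> multi_indices Is \<Longrightarrow> j < d \<Longrightarrow> column S j x = column T j x"
  shows "S = T"
  using assms by (intro tensor_eqI) (auto simp: column_def elim!: multi_indices_snocE)

lemma kernel_of_pencil:
  assumes "shape A = Is @ Is" "shape B = Is @ Is" "x \<in> multi_indices Is" "y \<in> multi_indices Is"
  shows "kernel_of (A -\<^sub>t c \<cdot>\<^sub>t B) x y = kernel_of A x y - c * kernel_of B x y"
  using assms by (simp add: kernel_of_def tensor_minus_def tensor_smult_def append_mem_multi_indices)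

lemma quad_on_pencil:
  assumes "shape A = Is @ Is" "shape B = Is @ Is"
  shows "quad_on (multi_indices Is) (kernel_of (A -\<^sub>t c \<cdot>\<^sub>t B)) f =
    quad_on (multi_indices Is) (kernel_of A) f - c * quad_on (multi_indices Is) (kernel_of B) f"
proof -
  let ?I = "multi_indices Is"
  have "apply_on ?I (kernel_of (A -\<^sub>t c \<cdot>\<^sub>t B)) f x =
      apply_on ?I (kernel_of A) f x + (- c) * apply_on ?I (kernel_of B) f x" if "x \<in> ?I" for x
    unfolding apply_on_def sum_distrib_left sum.distrib[symmetric]
    using that by (intro sum.cong refl) (simp add: kernel_of_pencil[OF assms] left_diff_distrib)
  then have "quad_on ?I (kernel_of (A -\<^sub>t c \<cdot>\<^sub>t B)) f =
      dot_on ?I f (\<lambda>x. apply_on ?I (kernel_of A) f x + (- c) * apply_on ?I (kernel_of B) f x)"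
    unfolding quad_on_def by (rule dot_on_cong[OF refl])
  then show ?thesis
    by (simp only: dot_on_linear quad_on_def)
qed

text \<open>
  Passage from the ratio to a difference: multiplying \<open>Tr (P'\<^sup>T A P') / Tr (P'\<^sup>T B P') \<le> \<rho>\<close> by the
  positive denominator linearizes the problem. The denominator is a sum of \<open>d \<ge> 1\<close> values of the
  positive definite form \<open>B\<close> at unit vectors.
\<close>

lemma trace_ratio_maximizer:
  assumes d: "d \<ge> 1" and A: "symmetric_tensor Is A" and sB: "symmetric_tensor Is B"
    and B: "pos_def_tensor Is B"
    and P: "is_arg_max (trace_ratio (length Is) A B) (\<lambda>P'. P' \<in> orthonormal_tensors Is d) P"
    and \<rho>: "\<rho> = trace_ratio (length Is) A B P"
  defines "q \<equiv> quad_on (multi_indices Is) (kernel_of (A -\<^sub>t \<rho> \<cdot>\<^sub>t B))"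
  shows "(\<Sum>j<d. q (column P j)) = 0"
    and "\<And>p'. orthonormal_on (multi_indices Is) d p' \<Longrightarrow> (\<Sum>j<d. q (p' j)) \<le> 0"
proof -
  let ?I = "multi_indices Is"
  let ?a = "\<lambda>p. \<Sum>j<d. quad_on ?I (kernel_of A) (p j)"
  let ?b = "\<lambda>p. \<Sum>j<d. quad_on ?I (kernel_of B) (p j)"
  have shapes: "shape A = Is @ Is" "shape B = Is @ Is"
    using A sB by (auto simp: symmetric_tensor_def)
  have ratio: "trace_ratio (length Is) A B P' = ?a (column P') / ?b (column P')"
    if "shape P' = Is @ [d]" for P'
    using that shapes by (simp add: trace_ratio_def mat_trace_congruence)
  have pos: "?b p > 0" if p: "orthonormal_on ?I d p" for p
  proof (rule sum_pos)
    show "quad_on ?I (kernel_of B) (p j) > 0" if "j \<in> {..<d}" for j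
    proof -
      have "dot_on ?I (p j) (p j) \<noteq> 0" using orthonormal_onD[OF p] that by simp
      then obtain x where "x \<in> ?I" "p j x * p j x \<noteq> 0"
        unfolding dot_on_def by (rule sum.not_neutral_contains_not_neutral)
      then have "x \<in> ?I" "p j x \<noteq> 0" by auto
      then show ?thesis by (rule pos_def_tensor_quad_pos[OF B])
    qed
  qed (use d in \<open>auto simp: lessThan_empty_iff\<close>)
  have q: "(\<Sum>j<d. q (p j)) = ?a p - \<rho> * ?b p" for p
    by (simp add: q_def quad_on_pencil[OF shapes] sum_subtractf sum_distrib_left)
  have P': "shape P = Is @ [d]" "orthonormal_on ?I d (column P)"
    using P by (auto simp: is_arg_max_def orthonormal_tensors_iff)
  show "(\<Sum>j<d. q (column P j)) = 0"
    using pos[OF P'(2)] by (simp add: q \<rho> ratio[OF P'(1)])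
  fix p' assume p': "orthonormal_on ?I d p'"
  let ?T = "tensor_of_columns Is d p'"
  have col: "quad_on ?I K (column ?T j) = quad_on ?I K (p' j)"
    "dot_on ?I (column ?T i) (column ?T j) = dot_on ?I (p' i) (p' j)"
    if "i < d" "j < d" for i j K
    using that by (simp_all add: quad_on_def dot_on_def apply_on_def column_tensor_of_columns)
  have "?T \<in> orthonormal_tensors Is d"
    using p' col by (simp add: orthonormal_tensors_iff shape_tensor_of_columns orthonormal_on_def)
  then have "trace_ratio (length Is) A B ?T \<le> \<rho>"
    using P by (simp add: is_arg_max_linorder \<rho>)
  then have "?a p' / ?b p' \<le> \<rho>"
    using col by (simp add: ratio shape_tensor_of_columns)
  then have "?a p' \<le> \<rho> * ?b p'"
    using pos[OF p'] by (simp add: divide_le_eq)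
  then show "(\<Sum>j<d. q (p' j)) \<le> 0"
    by (simp add: q)
qed

lemma real_orthogonal_mat_of_rows:
  assumes "orthonormal_on {..<n} n w"
  shows "real_orthogonal_mat (mat n n (\<lambda>(i, k). w i k))"
proof -
  let ?W = "mat n n (\<lambda>(i, k). w i k)"
  have "?W * transpose_mat ?W = 1\<^sub>m n"
    using orthonormal_onD[OF assms]
    by (intro eq_matI) (simp_all add: scalar_prod_def dot_on_def lessThan_atLeast0)
  moreover have "transpose_mat ?W * ?W = 1\<^sub>m n"
    using orthonormal_onD[OF orthonormal_rows_imp_columns[OF assms]]
    by (intro eq_matI) (simp_all add: scalar_prod_def dot_on_def lessThan_atLeast0)
  ultimately show ?thesis
    by (simp add: real_orthogonal_mat_def inverts_mat_def)
qed

theorem mainTheorem4: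
  fixes M d :: nat and Is :: "nat list" and A B P :: tensor and \<rho> :: real
  assumes "M \<ge> 1" and "length Is = M" and "\<forall>n\<in>set Is. n \<ge> 1"
    and "d \<ge> 1" and "d \<le> prod_list Is"
    and "symmetric_tensor Is A"
    and "symmetric_tensor Is B" and "pos_def_tensor Is B"
    and "is_arg_max (trace_ratio M A B) (\<lambda>P'. P' \<in> orthonormal_tensors Is d) P"
    and "\<rho> = trace_ratio M A B P"
  shows "\<exists>V S Q.
           V \<in> carrier_mat d d \<and> real_orthogonal_mat V \<and>
           S \<in> carrier_mat d d \<and> diagonal_mat S \<and> mat_trace S = 0 \<and>
           Q = P \<times>\<^bsub>M + 1\<^esub> V \<and>
           mat_of_tensor (tensor_transpose M Q \<star>\<^bsub>M\<^esub> Q) = 1\<^sub>m d \<and>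
           (A -\<^sub>t \<rho> \<cdot>\<^sub>t B) \<star>\<^bsub>M\<^esub> Q = Q \<times>\<^bsub>M + 1\<^esub> S"
proof -
  let ?I = "multi_indices Is"
  let ?G = "A -\<^sub>t \<rho> \<cdot>\<^sub>t B"
  have M: "M = length Is" using assms(2) by simp
  have shapes: "shape A = Is @ Is" "shape B = Is @ Is"
    using assms(6,7) by (auto simp: symmetric_tensor_def)
  then have G: "shape ?G = Is @ Is"
    by (simp add: tensor_minus_def tensor_smult_def)
  have P: "shape P = Is @ [d]" and on: "orthonormal_on ?I d (column P)"
    using assms(9) by (auto simp: is_arg_max_def orthonormal_tensors_iff)
  note max = trace_ratio_maximizer[OF assms(4,6-8) assms(9,10)[unfolded M]]
  have sym: "symmetric_on ?I (kernel_of ?G)"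
    using symmetric_tensor_imp_symmetric_on[OF assms(6)]
      symmetric_tensor_imp_symmetric_on[OF assms(7)]
    by (simp add: symmetric_on_def kernel_of_pencil[OF shapes])
  have max': "(\<Sum>j<d. quad_on ?I (kernel_of ?G) (p' j)) \<le>
      (\<Sum>j<d. quad_on ?I (kernel_of ?G) (column P j))" if "orthonormal_on ?I d p'" for p'
    using max(2)[OF that] by (simp only: max(1))
  obtain w s where w: "orthonormal_on {..<d} d w"
    and tr: "(\<Sum>j<d. s j) = (\<Sum>j<d. quad_on ?I (kernel_of ?G) (column P j))"
    and ev: "\<And>j x. j < d \<Longrightarrow> x \<in> ?I \<Longrightarrow> apply_on ?I (kernel_of ?G)
      (\<lambda>x. \<Sum>k<d. w j k * column P k x) x = s j * (\<Sum>k<d. w j k * column P k x)"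
    using max_trace_eigenbasis[OF finite_multi_indices sym on max'] by blast
  define V where "V = mat d d (\<lambda>(i, k). w i k)"
  define S where "S = mat d d (\<lambda>(i, k). if i = k then s i else 0)"
  define Q where "Q = P \<times>\<^bsub>length Is + 1\<^esub> V"
  have V: "V \<in> carrier_mat d d" and S: "S \<in> carrier_mat d d"
    by (simp_all add: V_def S_def)
  have Q: "shape Q = Is @ [d]"
    unfolding Q_def by (rule shape_mode_prod_last[OF P V])
  have colQ: "column Q j x = (\<Sum>k<d. w j k * column P k x)" if "x \<in> ?I" "j < d" for j x
    using column_mode_prod[OF P V that] that by (simp add: Q_def V_def)
  have "orthonormal_on ?I d (column Q)"
    using orthonormal_on_rotate[OF on w] colQ by (simp add: orthonormal_on_def dot_on_def)
  then have "Q \<in> orthonormal_tensors Is d"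
    using Q by (simp add: orthonormal_tensors_iff)
  then have QQ: "mat_of_tensor (tensor_transpose M Q \<star>\<^bsub>M\<^esub> Q) = 1\<^sub>m d"
    by (simp add: orthonormal_tensors_def M)
  have "?G \<star>\<^bsub>length Is\<^esub> Q = Q \<times>\<^bsub>length Is + 1\<^esub> S"
  proof (rule tensor_eq_columnsI)
    show "shape (?G \<star>\<^bsub>length Is\<^esub> Q) = Is @ [d]"
      by (rule shape_einstein_prod[OF G Q refl])
    show "shape (Q \<times>\<^bsub>length Is + 1\<^esub> S) = Is @ [d]"
      by (rule shape_mode_prod_last[OF Q S])
    fix x j assume x: "x \<in> ?I" and j: "j < d"
    have "column (?G \<star>\<^bsub>length Is\<^esub> Q) j x = apply_on ?I (kernel_of ?G) (column Q j) x"
      by (rule column_einstein_prod[OF G Q x j])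
    also have "\<dots> = apply_on ?I (kernel_of ?G) (\<lambda>x. \<Sum>k<d. w j k * column P k x) x"
      using colQ[OF _ j] by (simp add: apply_on_def)
    also have "\<dots> = s j * column Q j x"
      using ev[OF j x] colQ[OF x j] by simp
    also have "\<dots> = (\<Sum>k<d. if k = j then s j * column Q j x else 0)"
      using j by simp
    also have "\<dots> = (\<Sum>k<d. S $$ (j, k) * column Q k x)"
      using j by (intro sum.cong) (auto simp: S_def)
    also have "\<dots> = column (Q \<times>\<^bsub>length Is + 1\<^esub> S) j x"
      by (rule column_mode_prod[OF Q S x j, symmetric])
    finally show "column (?G \<star>\<^bsub>length Is\<^esub> Q) j x = column (Q \<times>\<^bsub>length Is + 1\<^esub> S) j x" .
  qed
  moreover have "real_orthogonal_mat V"
    unfolding V_def by (rule real_orthogonal_mat_of_rows[OF w])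
  moreover have "diagonal_mat S" "mat_trace S = 0"
    using tr[unfolded max(1)] by (simp_all add: diagonal_mat_def mat_trace_def S_def)
  ultimately show ?thesis
    using V S QQ Q_def M by blast
qed

end
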